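(* Let $d\ge 3$, $\sigma>0$, and let $\alpha$ be a probability measure on $\mathbb{R}^d$ whose support $\mathcal{M}$ is a polar set. Let $Y$ be the time-reversed process and $\zeta$ its hitting time of $\mathcal{M}$, as defined in the context. Let $\delta,\varepsilon>0$ and fix $y\in\mathbb{R}^d$. If $\alpha(B(y,r))>\varepsilon$ for some ball $B(y,r)$ of radius $r>0$ centred at $y$, then $$\mathbb{P}^{Y_\zeta\mid Y_0=y}\bigl(\mathcal{M}\cap B(y,(1+\delta)r)\bigr)\;\ge\;1-\frac{1}{\varepsilon}(1+\delta)^{2-d}.$$
   Context: A set $\mathcal{M}\subset\mathbb{R}^d$ is polar if a $d$-dimensional Brownian motion with arbitrary initial law almost surely does not hit $\mathcal{M}$ at any time $t>0$. $|\cdot|$ is the Euclidean norm and $B(y,r)$ the ball of radius $r$ centred at $y$. Forward process: $X_0\sim\alpha$, $W$ is a standard $d$-dimensional Brownian motion with $W_0=0$, $\tau$ is exponentially distributed with parameter $1/\sigma^2$, and $X_0,W,\tau$ are independent. Set $X_t:=X_0+W_{t\wedge\tau}$ for $t\ge0$. Backward process: $Y_s:=X_{(\tau-s)\vee 0}$ for $s\ge0$, and $\zeta:=\inf\{s\ge0: Y_s\in\mathcal{M}\}$. Kernel: with $\nu:=(d-2)/2$ and $K_\nu$ the modified Bessel function of the second kind, $$G_{\sigma^2}(x,y):=(2\pi)^{-d/2}\,\frac{2}{\sigma^2}\Bigl(\frac{\sqrt2}{\sigma|x-y|}\Bigr)^{\nu}K_\nu\Bigl(\frac{\sqrt2\,|x-y|}{\sigma}\Bigr),\qquad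 h(y):=\int G_{\sigma^2}(x,y)\,\alpha(dx).$$ Conditional laws: $\mathbb{P}^{Y_\zeta\mid Y_0=y}$ denotes the conditional law of $Y_\zeta$ given $Y_0=y$ (it coincides with the posterior law of $X_0$ given $X_\tau=y$ for Lebesgue-almost all $y$). It is taken in the version $$\mathbb{P}^{Y_\zeta\mid Y_0=y}(dx)=\frac{G_{\sigma^2}(x,y)}{h(y)}\,\alpha(dx)\quad\text{for } y\notin\mathcal{M},$$ and for $y\in\mathcal{M}$ one has $\zeta=0$, so that $\mathbb{P}^{Y_\zeta\mid Y_0=y}$ is the Dirac measure at $y$. *)

theory Defs
  imports "HOL-Probability.Probability"
begin

definition gaussian_density :: "real \<Rightarrow> 'a::euclidean_space \<Rightarrow> real" where
  "gaussian_density u x =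
     (2 * pi * u) powr (- real DIM('a) / 2) * exp (- (norm x)\<^sup>2 / (2 * u))"

text \<open>
  A Brownian motion with time set \<open>{0..}\<close> and arbitrary initial law: \<open>B 0\<close> and the increments
  over successive intervals are mutually independent. Values at negative times are irrelevant.
\<close>
definition brownian_motion :: "'w measure \<Rightarrow> (real \<Rightarrow> 'w \<Rightarrow> 'a::euclidean_space) \<Rightarrow> bool" where
  "brownian_motion P B \<longleftrightarrow>
     prob_space P \<and>
     (\<forall>t\<ge>0. B t \<in> borel_measurable P) \<and>
     (\<forall>n (t :: nat \<Rightarrow> real). t 0 = 0 \<and> strict_mono_on {..n} t \<longrightarrow>
        prob_space.indep_vars P (\<lambda>_. borel)
          (\<lambda>i \<omega>. if i = 0 then B 0 \<omega> else B (t i) \<omega> - B (t (i - 1)) \<omega>) {..n}) \<and>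
     (\<forall>s t. 0 \<le> s \<and> s < t \<longrightarrow>
        distributed P lborel (\<lambda>\<omega>. B t \<omega> - B s \<omega>) (\<lambda>x. ennreal (gaussian_density (t - s) x))) \<and>
     (AE \<omega> in P. continuous_on {0..} (\<lambda>t. B t \<omega>))"

text \<open>
  A definition cannot quantify over the type of the sample space. Taking the type of paths
  \<open>real \<Rightarrow> 'a\<close> is no restriction for closed sets: every Brownian motion can be transported to path
  space, and whether it hits a closed set at a positive time almost surely depends only on its law.
\<close>
definition polar :: "'a::euclidean_space set \<Rightarrow> bool" where
  "polar M \<longleftrightarrow>
     (\<forall>(P :: (real \<Rightarrow> 'a) measure) B. brownian_motion P B \<longrightarrow>
        (AE \<omega> in P. \<forall>t>0. B t \<omega> \<notin> M))"

definition measure_support :: "'a::topological_space measure \<Rightarrow> 'a set" where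
  "measure_support \<alpha> = {x. \<forall>U. open U \<and> x \<in> U \<longrightarrow> emeasure \<alpha> U > 0}"

definition gen_events :: "'w measure \<Rightarrow> ('w \<Rightarrow> 'b) \<Rightarrow> 'b measure \<Rightarrow> 'w set set" where
  "gen_events P f N = sets (vimage_algebra (space P) f N)"

definition forward_process ::
    "('w \<Rightarrow> 'a::euclidean_space) \<Rightarrow> (real \<Rightarrow> 'w \<Rightarrow> 'a) \<Rightarrow> ('w \<Rightarrow> real) \<Rightarrow> real \<Rightarrow> 'w \<Rightarrow> 'a" where
  "forward_process X0 W \<tau> t \<omega> = X0 \<omega> + W (min t (\<tau> \<omega>)) \<omega>"

definition backward_process ::
    "('w \<Rightarrow> 'a::euclidean_space) \<Rightarrow> (real \<Rightarrow> 'w \<Rightarrow> 'a) \<Rightarrow> ('w \<Rightarrow> real) \<Rightarrow> real \<Rightarrow> 'w \<Rightarrow> 'a" where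
  "backward_process X0 W \<tau> s \<omega> = forward_process X0 W \<tau> (max (\<tau> \<omega> - s) 0) \<omega>"

text \<open>
  Real-valued: if \<open>W 0 = 0\<close> and \<open>X0 \<in> M\<close> almost surely, the set below almost surely contains
  \<open>\<tau> \<omega>\<close>, so the value of \<open>Inf {}\<close> only matters on a null event.
\<close>
definition hitting_time :: "(real \<Rightarrow> 'w \<Rightarrow> 'a) \<Rightarrow> 'a set \<Rightarrow> 'w \<Rightarrow> real" where
  "hitting_time Y M \<omega> = Inf {s. 0 \<le> s \<and> Y s \<omega> \<in> M}"

text \<open>
  \<open>K\<^sub>\<nu>(z)\<close> for \<open>z > 0\<close> and any real order, by the integral
  \<open>\<integral>\<^sub>0\<^sup>\<infinity> exp (- z cosh t) cosh (\<nu> t) dt\<close>; unlike the formula in terms of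
  \<open>I\<^sub>\<nu>\<close> and \<open>I\<^sub>-\<^sub>\<nu>\<close> it needs no limit at integer orders.
\<close>
definition bessel_K :: "real \<Rightarrow> real \<Rightarrow> real" where
  "bessel_K \<nu> z = (LBINT t:{0..}. exp (- z * cosh t) * cosh (\<nu> * t))"

text \<open>
  The kernel \<open>G\<close> with parameter \<open>\<sigma>\<^sup>2\<close>, written in terms of \<open>\<sigma>\<close>. Its value \<open>0\<close> (instead of
  \<open>\<infinity>\<close>) on the diagonal is an artefact of division by zero; below, \<open>G\<close> is only used for
  \<open>x\<close> in the support of \<open>\<alpha>\<close> and \<open>y\<close> outside of it.
\<close>
definition G_kernel :: "real \<Rightarrow> 'a::euclidean_space \<Rightarrow> 'a \<Rightarrow> real" where
  "G_kernel \<sigma> x y =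
     (let \<nu> = (real DIM('a) - 2) / 2 in
        (2 * pi) powr (- real DIM('a) / 2) * (2 / \<sigma>\<^sup>2)
          * (sqrt 2 / (\<sigma> * norm (x - y))) powr \<nu>
          * bessel_K \<nu> (sqrt 2 * norm (x - y) / \<sigma>))"

definition h_fun :: "real \<Rightarrow> 'a::euclidean_space measure \<Rightarrow> 'a \<Rightarrow> real" where
  "h_fun \<sigma> \<alpha> y = (\<integral>x. G_kernel \<sigma> x y \<partial>\<alpha>)"

text \<open>
  \<open>\<kappa>\<close> is a regular conditional law of \<open>V\<close> given \<open>U\<close>. The completion of \<open>P\<close> is needed because
  \<open>Y 0\<close> and \<open>Y \<zeta>\<close> are in general only almost surely equal to measurable functions.
\<close>
definition regular_conditional_law ::
    "'w measure \<Rightarrow> ('w \<Rightarrow> 'a::topological_space) \<Rightarrow> ('w \<Rightarrow> 'b::topological_space)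
       \<Rightarrow> ('a \<Rightarrow> 'b measure) \<Rightarrow> bool" where
  "regular_conditional_law P U V \<kappa> \<longleftrightarrow>
     U \<in> borel_measurable (completion P) \<and>
     V \<in> borel_measurable (completion P) \<and>
     \<kappa> \<in> borel \<rightarrow>\<^sub>M prob_algebra borel \<and>
     (\<forall>A\<in>sets borel. \<forall>B\<in>sets borel.
        emeasure (completion P) {\<omega> \<in> space P. U \<omega> \<in> A \<and> V \<omega> \<in> B} =
          (\<integral>\<^sup>+u\<in>A. emeasure (\<kappa> u) B \<partial>distr (completion P) borel U))"

end

theory Submission
  imports Defs
begin

text \<open>
  The kernel depends only on \<open>\<rho> = |x - y|\<close>, is decreasing in \<open>\<rho>\<close>, and decays at least as fast as the
  Newtonian kernel: \<open>\<rho>\<^sup>d\<^sup>-\<^sup>2 G\<close> is decreasing too, because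
  \<open>z\<^sup>\<nu> K\<^sub>\<nu>(z) = 1/2 \<integral> exp (\<nu> u - (e\<^sup>u + z\<^sup>2 e\<^sup>-\<^sup>u) / 2) du\<close>. Hence the kernel outside
  \<open>B(y, (1 + \<delta>) r)\<close> is at most \<open>(1 + \<delta>)\<^sup>2\<^sup>-\<^sup>d\<close> times its values in \<open>B(y, r)\<close>, and these
  contribute at least \<open>\<epsilon>\<close> times their minimum to \<open>h(y)\<close>.
\<close>

section \<open>Integral representations and monotonicity of the Bessel function\<close>

lemma bessel_K_integrand_nonneg: "0 \<le> exp (- z * cosh t) * cosh (\<nu> * t)" for z t \<nu> :: real
  by (simp add: cosh_real_pos less_imp_le)

text \<open>The double exponential decay of \<open>exp (- z * cosh t)\<close> beats the growth of
  \<open>cosh (\<nu> * t)\<close>; an explicit multiple of \<open>exp (- t)\<close> serves as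
  dominating function.\<close>

lemma set_integrable_bessel_K:
  fixes \<nu> z :: real
  assumes z: "z > 0"
  shows "set_integrable lborel {0..} (\<lambda>t. exp (- z * cosh t) * cosh (\<nu> * t))"
proof -
  \<comment> \<open>The slope \<open>b\<close> is one more than the growth rate
    \<open>\<bar>\<nu>\<bar>\<close> of the second factor, so that a factor \<open>exp (- t)\<close>
    survives. The point \<open>a\<close> is where the convex function \<open>z * exp t / 2\<close>
    has slope \<open>b\<close>; its tangent there bounds \<open>z * cosh t\<close> from
    below.\<close>
  define b where "b = \<bar>\<nu>\<bar> + 1"
  define a where "a = ln (2 * b / z)"
  have b: "b > 0" by (simp add: b_def)
  have bound: "exp (- z * cosh t) * cosh (\<nu> * t) \<le> exp (b * (a - 1)) * exp (- t)" if "t \<ge> 0" for t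
  proof -
    have e: "exp a = 2 * b / z"
      unfolding a_def using b z by simp
    have "b * (1 + (t - a)) \<le> b * exp (t - a)"
      using b exp_ge_add_one_self by (intro mult_left_mono) auto
    also have "\<dots> = z * (exp t / 2)"
      using e b z by (simp add: exp_diff field_simps)
    also have "\<dots> \<le> z * cosh t"
      using z by (intro mult_left_mono) (auto simp: cosh_field_def)
    finally have 1: "b * (1 + (t - a)) \<le> z * cosh t" .
    have "\<nu> * t \<le> \<bar>\<nu>\<bar> * t" "- (\<nu> * t) \<le> \<bar>\<nu>\<bar> * t"
      using that by (auto simp: abs_if mult_nonneg_nonneg mult_nonpos_nonneg)
    then have "exp (\<nu> * t) \<le> exp (\<bar>\<nu>\<bar> * t)" "exp (- (\<nu> * t)) \<le> exp (\<bar>\<nu>\<bar> * t)"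
      by simp_all
    then have "exp (\<nu> * t) + exp (- (\<nu> * t)) \<le> exp (\<bar>\<nu>\<bar> * t) + exp (\<bar>\<nu>\<bar> * t)"
      by (rule add_mono)
    then have 2: "cosh (\<nu> * t) \<le> exp (\<bar>\<nu>\<bar> * t)"
      by (simp add: cosh_field_def)
    have "exp (- z * cosh t) * cosh (\<nu> * t) \<le> exp (- (b * (1 + (t - a)))) * exp (\<bar>\<nu>\<bar> * t)"
      using 1 2 by (intro mult_mono) (auto simp: less_imp_le cosh_real_pos)
    also have "\<dots> = exp (b * (a - 1)) * exp (- t)"
      unfolding exp_add[symmetric] by (simp add: b_def algebra_simps)
    finally show ?thesis .
  qed
  have "integrable lborel (\<lambda>t. exp (- t) * indicator {0..} t :: real)"
    using nn_intergal_power_times_exp_Ici[of 0]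
    by (intro integrableI_nonneg)
       (auto simp: ennreal_mult ennreal_indicator)
  then have "integrable lborel (\<lambda>t. exp (b * (a - 1)) * (exp (- t) * indicator {0..} t :: real))"
    by simp
  then show ?thesis
    unfolding set_integrable_def
  proof (rule Bochner_Integration.integrable_bound)
    show "(\<lambda>t. indicator {0..} t *\<^sub>R (exp (- z * cosh t) * cosh (\<nu> * t))) \<in> borel_measurable lborel"
      unfolding cosh_field_def by measurable
    show "AE t in lborel. norm (indicator {0..} t *\<^sub>R (exp (- z * cosh t) * cosh (\<nu> * t)))
        \<le> norm (exp (b * (a - 1)) * (exp (- t) * indicator {0..} t :: real))"
      using bound bessel_K_integrand_nonneg[of z _ \<nu>]
      by (intro AE_I2) (auto simp: indicator_def abs_mult)
  qed
qed

lemma bessel_K_nonneg: "bessel_K \<nu> z \<ge> 0"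
  unfolding bessel_K_def set_lebesgue_integral_def
  using bessel_K_integrand_nonneg
  by (intro Bochner_Integration.integral_nonneg) (auto simp: indicator_def)

lemma bessel_K_antimono:
  assumes "0 < z" "z \<le> w"
  shows "bessel_K \<nu> w \<le> bessel_K \<nu> z"
  unfolding bessel_K_def using assms
  by (intro set_integral_mono set_integrable_bessel_K)
     (auto intro!: mult_right_mono simp: cosh_real_pos less_imp_le)

text \<open>Folding the negative half-line onto the positive one turns
  \<open>exp (\<nu> * t)\<close> into \<open>2 * cosh (\<nu> * t)\<close>, since \<open>cosh\<close>
  is even. An integral over the whole line can then be translated freely.\<close>

lemma nn_integral_bessel_K:
  fixes \<nu> z :: real
  assumes z: "z > 0"
  shows "(\<integral>\<^sup>+t. ennreal (exp (\<nu> * t - z * cosh t)) \<partial>lborel) = ennreal (2 * bessel_K \<nu> z)"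
proof -
  define f where "f t = ennreal (exp (\<nu> * t - z * cosh t))" for t
  have [measurable]: "f \<in> borel_measurable borel"
    unfolding f_def cosh_field_def by measurable
  have "(\<integral>\<^sup>+t. f t \<partial>lborel) =
      (\<integral>\<^sup>+t. f t * indicator {0..} t + f t * indicator {..<0} t \<partial>lborel)"
    by (intro nn_integral_cong) (auto simp: indicator_def)
  also have "\<dots> = (\<integral>\<^sup>+t. f t * indicator {0..} t \<partial>lborel) + (\<integral>\<^sup>+t. f t * indicator {..<0} t \<partial>lborel)"
    by (intro nn_integral_add) auto
  also have "(\<integral>\<^sup>+t. f t * indicator {..<0} t \<partial>lborel) = (\<integral>\<^sup>+t. f (- t) * indicator {0<..} t \<partial>lborel)"
    by (subst nn_integral_real_affine[where c = "-1" and t = 0])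
       (auto intro!: nn_integral_cong simp: indicator_def)
  also have "\<dots> = (\<integral>\<^sup>+t. f (- t) * indicator {0..} t \<partial>lborel)"
    using AE_lborel_singleton[of "0::real"]
    by (intro nn_integral_cong_AE, eventually_elim) (auto simp: indicator_def)
  also have "(\<integral>\<^sup>+t. f t * indicator {0..} t \<partial>lborel) + (\<integral>\<^sup>+t. f (- t) * indicator {0..} t \<partial>lborel)
      = (\<integral>\<^sup>+t. f t * indicator {0..} t + f (- t) * indicator {0..} t \<partial>lborel)"
    by (intro nn_integral_add[symmetric]) auto
  also have "\<dots> = (\<integral>\<^sup>+t. ennreal (2 * (indicator {0..} t *\<^sub>R (exp (- z * cosh t) * cosh (\<nu> * t)))) \<partial>lborel)"
  proof (intro nn_integral_cong)
    fix t :: real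
    have "exp (\<nu> * t - z * cosh t) + exp (\<nu> * (- t) - z * cosh (- t))
        = 2 * (exp (- z * cosh t) * cosh (\<nu> * t))"
      by (simp add: cosh_field_def[of "\<nu> * t"] exp_diff exp_minus field_simps)
    then show "f t * indicator {0..} t + f (- t) * indicator {0..} t
        = ennreal (2 * (indicator {0..} t *\<^sub>R (exp (- z * cosh t) * cosh (\<nu> * t))))"
      unfolding f_def by (auto simp: indicator_def ennreal_plus[symmetric] simp del: ennreal_plus)
  qed
  also have "\<dots> = ennreal (\<integral>t. 2 * (indicator {0..} t *\<^sub>R (exp (- z * cosh t) * cosh (\<nu> * t))) \<partial>lborel)"
    using set_integrable_bessel_K[OF z, of \<nu>] bessel_K_integrand_nonneg[of z _ \<nu>]
    unfolding set_integrable_def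
    by (intro nn_integral_eq_integral integrable_mult_right AE_I2) (auto simp: indicator_def)
  also have "\<dots> = ennreal (2 * bessel_K \<nu> z)"
    unfolding bessel_K_def set_lebesgue_integral_def by (subst integral_mult_right_zero) simp
  finally show ?thesis
    by (simp add: f_def)
qed

text \<open>Substitute \<open>u = ln z + t\<close>: the power of \<open>z\<close> is absorbed into
  \<open>exp (\<nu> * u)\<close>, and \<open>z * cosh t\<close> becomes
  \<open>(exp u + z\<^sup>2 * exp (- u)) / 2\<close>.\<close>

lemma powr_times_bessel_K:
  fixes \<nu> z :: real
  assumes z: "z > 0"
  shows "ennreal (2 * (z powr \<nu> * bessel_K \<nu> z)) =
    (\<integral>\<^sup>+u. ennreal (exp (\<nu> * u - (exp u + z\<^sup>2 * exp (- u)) / 2)) \<partial>lborel)"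
proof -
  have "ennreal (2 * (z powr \<nu> * bessel_K \<nu> z)) = ennreal (z powr \<nu>) * ennreal (2 * bessel_K \<nu> z)"
    by (simp add: ennreal_mult[symmetric] bessel_K_nonneg algebra_simps)
  also have "\<dots> = (\<integral>\<^sup>+t. ennreal (z powr \<nu>) * ennreal (exp (\<nu> * t - z * cosh t)) \<partial>lborel)"
    unfolding nn_integral_bessel_K[OF z, symmetric] cosh_field_def
    by (intro nn_integral_cmult[symmetric]) measurable
  also have "\<dots> = (\<integral>\<^sup>+t. ennreal (exp (\<nu> * (ln z + t)
      - (exp (ln z + t) + z\<^sup>2 * exp (- (ln z + t))) / 2)) \<partial>lborel)"
    using z
    by (intro nn_integral_cong)
       (simp add: powr_def ennreal_mult[symmetric] exp_add[symmetric],
        simp add: cosh_field_def exp_add exp_diff exp_minus field_simps power2_eq_square)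
  also have "\<dots> = (\<integral>\<^sup>+u. ennreal (exp (\<nu> * u - (exp u + z\<^sup>2 * exp (- u)) / 2)) \<partial>lborel)"
    by (subst (2) nn_integral_real_affine[where c = 1 and t = "ln z"]) auto
  finally show ?thesis .
qed

text \<open>After the substitution \<open>z\<close> enters only through
  \<open>- z\<^sup>2 * exp (- u) / 2\<close>, so the integrand decreases pointwise in
  \<open>z\<close>, whatever the sign of \<open>\<nu>\<close>.\<close>

lemma powr_times_bessel_K_antimono:
  fixes \<nu> z w :: real
  assumes "0 < z" "z \<le> w"
  shows "w powr \<nu> * bessel_K \<nu> w \<le> z powr \<nu> * bessel_K \<nu> z"
proof -
  have "ennreal (2 * (w powr \<nu> * bessel_K \<nu> w)) \<le> ennreal (2 * (z powr \<nu> * bessel_K \<nu> z))"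
    using assms
    by (subst (1 2) powr_times_bessel_K)
       (auto intro!: nn_integral_mono ennreal_leI power_mono)
  then show ?thesis
    using assms by (simp add: bessel_K_nonneg)
qed

lemma borel_measurable_bessel_K [measurable]: "bessel_K \<nu> \<in> borel_measurable borel"
proof -
  have [measurable]: "cosh \<in> borel_measurable (borel :: real measure)"
    unfolding cosh_field_def by measurable
  show ?thesis
    unfolding bessel_K_def set_lebesgue_integral_def by measurable
qed

section \<open>Monotonicity and decay of the kernel\<close>

lemma borel_measurable_G_kernel [measurable]:
  "(\<lambda>x. G_kernel \<sigma> x y) \<in> borel_measurable borel"
  unfolding G_kernel_def Let_def by measurable

lemma G_kernel_nonneg: "G_kernel \<sigma> x y \<ge> 0"
  unfolding G_kernel_def Let_def by (simp add: bessel_K_nonneg)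

text \<open>In dimension at least 2 the order \<nu> is nonnegative, so the power and the Bessel
  factor both decrease with the distance. The point \<open>x = y\<close> is excluded because there
  the formal value of the kernel is 0.\<close>

lemma G_kernel_antimono:
  fixes x x' y :: "'a::euclidean_space"
  assumes \<sigma>: "\<sigma> > 0" and dim: "DIM('a) \<ge> 2"
    and x: "x \<noteq> y" "norm (x - y) \<le> norm (x' - y)"
  shows "G_kernel \<sigma> x' y \<le> G_kernel \<sigma> x y"
proof -
  have "norm (x - y) > 0" using x by simp
  with \<sigma> dim x(2) show ?thesis
    unfolding G_kernel_def Let_def
    by (intro mult_mono bessel_K_antimono powr_mono2 divide_left_mono divide_right_mono
        mult_left_mono mult_pos_pos divide_pos_pos)
       (auto simp: bessel_K_nonneg intro!: mult_nonneg_nonneg)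
qed

text \<open>With \<open>w\<close> the rescaled distance, the kernel is a constant times
  \<open>w powr (- 2 * \<nu>)\<close> times \<open>w powr \<nu> * bessel_K \<nu> w\<close>. Since
  \<open>2 * \<nu>\<close> is the dimension minus 2, the first power yields exactly the Newtonian
  factor, and the remaining product is decreasing.\<close>

lemma G_kernel_decay:
  fixes x x' y :: "'a::euclidean_space"
  assumes \<sigma>: "\<sigma> > 0" and c: "c \<ge> 1"
    and x: "x \<noteq> y" "norm (x' - y) = c * norm (x - y)"
  shows "G_kernel \<sigma> x' y \<le> c powr (2 - real DIM('a)) * G_kernel \<sigma> x y"
proof -
  define \<nu> where "\<nu> = (real DIM('a) - 2) / 2"
  define z where "z = sqrt 2 * norm (x - y) / \<sigma>"
  define C where "C = (2 * pi) powr (- real DIM('a) / 2) * (2 / \<sigma>\<^sup>2) * (2 / \<sigma>\<^sup>2) powr \<nu>"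
  have z: "z > 0" using x \<sigma> by (simp add: z_def)
  have cz: "sqrt 2 * norm (x' - y) / \<sigma> = c * z"
    by (simp add: x z_def)
  \<comment> \<open>Expresses the base of the power in the kernel through the Bessel argument; this
    is the source of \<open>(2 / \<sigma>\<^sup>2) powr \<nu>\<close> in \<open>C\<close>. For
    \<open>n = 0\<close> both sides are 0 by the convention for division.\<close>
  have e: "sqrt 2 / (\<sigma> * n) = (2 / \<sigma>\<^sup>2) / (sqrt 2 * n / \<sigma>)" for n
    using \<sigma> by (cases "n = 0") (auto simp: field_simps power2_eq_square)
  have G: "G_kernel \<sigma> v y = C * (w powr (- 2 * \<nu>) * (w powr \<nu> * bessel_K \<nu> w))"
    if w: "w = sqrt 2 * norm (v - y) / \<sigma>" "w > 0" for v w
  proof -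
    have "(sqrt 2 / (\<sigma> * norm (v - y))) powr \<nu> = (2 / \<sigma>\<^sup>2) powr \<nu> * w powr (- \<nu>)"
      unfolding e w(1)[symmetric] using w(2) by (simp add: powr_divide powr_minus powr_mult divide_simps)
    also have "w powr (- \<nu>) = w powr (- 2 * \<nu>) * w powr \<nu>"
      by (simp add: powr_add[symmetric])
    finally show ?thesis
      unfolding G_kernel_def Let_def \<nu>_def[symmetric] w(1)[symmetric] C_def
      by (simp add: mult_ac)
  qed
  have "G_kernel \<sigma> x' y = C * ((c * z) powr (- 2 * \<nu>) * ((c * z) powr \<nu> * bessel_K \<nu> (c * z)))"
    using c z by (intro G) (simp_all add: cz)
  also have "\<dots> \<le> C * ((c * z) powr (- 2 * \<nu>) * (z powr \<nu> * bessel_K \<nu> z))"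
    using c z
    by (intro mult_left_mono powr_times_bessel_K_antimono) (auto simp: C_def)
  also have "\<dots> = c powr (- 2 * \<nu>) * (C * (z powr (- 2 * \<nu>) * (z powr \<nu> * bessel_K \<nu> z)))"
    using c z by (simp add: powr_mult mult_ac)
  also have "C * (z powr (- 2 * \<nu>) * (z powr \<nu> * bessel_K \<nu> z)) = G_kernel \<sigma> x y"
    using z by (intro G[symmetric]) (simp_all add: z_def)
  also have "- 2 * \<nu> = 2 - real DIM('a)"
    by (simp add: \<nu>_def)
  finally show ?thesis .
qed

section \<open>The support of a measure\<close>

lemma closed_measure_support: "closed (measure_support \<alpha>)"
proof -
  have "- measure_support \<alpha> = \<Union>{U. open U \<and> emeasure \<alpha> U = 0}"
    unfolding measure_support_def by (auto simp: zero_less_iff_neq_zero)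
  then show ?thesis
    unfolding closed_def by (auto intro!: open_Union)
qed

text \<open>The complement of the support is the union of all open null sets. By Lindelof countably
  many of them already cover it, so it is itself a null set.\<close>

lemma AE_in_measure_support:
  fixes \<alpha> :: "'a::second_countable_topology measure"
  assumes "sets \<alpha> = sets borel"
  shows "AE x in \<alpha>. x \<in> measure_support \<alpha>"
proof -
  obtain \<U> where \<U>: "\<U> \<subseteq> {U. open U \<and> emeasure \<alpha> U = 0}" "countable \<U>"
    "\<Union>\<U> = \<Union>{U. open U \<and> emeasure \<alpha> U = 0}"
    using Lindelof[of "{U. open U \<and> emeasure \<alpha> U = 0}"] by blast
  have "\<forall>U\<in>\<U>. AE x in \<alpha>. x \<notin> U"
    using \<U>(1) assms by (auto intro!: AE_not_in null_setsI)
  then have "AE x in \<alpha>. \<forall>U\<in>\<U>. x \<notin> U"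
    using \<U>(2) by (simp add: AE_ball_countable)
  then show ?thesis
    by eventually_elim (use \<U>(3) in \<open>auto simp: measure_support_def zero_less_iff_neq_zero\<close>)
qed

section \<open>The posterior mass far from the observed point\<close>

lemma G_posterior_outside_ball:
  fixes \<alpha> :: "'a::euclidean_space measure" and y :: 'a
  assumes dim: "DIM('a) \<ge> 2" and \<sigma>: "\<sigma> > 0"
    and \<alpha>: "prob_space \<alpha>" "sets \<alpha> = sets borel"
    and y: "y \<notin> measure_support \<alpha>"
    and \<kappa>: "prob_space (density \<alpha> (\<lambda>x. ennreal (G_kernel \<sigma> x y / h_fun \<sigma> \<alpha> y)))"
    and pos: "\<delta> > 0" "\<epsilon> > 0" "r > 0"
    and mass: "measure \<alpha> (ball y r) > \<epsilon>"
  shows "measure (density \<alpha> (\<lambda>x. ennreal (G_kernel \<sigma> x y / h_fun \<sigma> \<alpha> y)))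
           (- ball y ((1 + \<delta>) * r)) \<le> (1 / \<epsilon>) * (1 + \<delta>) powr (2 - real DIM('a))"
proof -
  interpret \<alpha>: prob_space \<alpha> by fact
  define h where "h = h_fun \<sigma> \<alpha> y"
  note [measurable_cong] = \<alpha>(2)
  \<comment> \<open>Dividing by \<open>h = 0\<close> would give the zero density, contradicting
    total mass 1. As the integral of a non-integrable function is 0 by default, this also yields the
    integrability of the kernel below.\<close>
  have "h \<noteq> 0"
  proof
    assume "h = 0"
    then have "density \<alpha> (\<lambda>x. ennreal (G_kernel \<sigma> x y / h_fun \<sigma> \<alpha> y)) = density \<alpha> (\<lambda>_. 0)"
      by (simp add: h_def)
    then show False
      using prob_space.emeasure_space_1[OF \<kappa>] by (simp add: emeasure_density)
  qed
  moreover have "h \<ge> 0"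
    unfolding h_def h_fun_def by (simp add: G_kernel_nonneg)
  ultimately have h: "h > 0" by simp
  have int: "integrable \<alpha> (\<lambda>x. G_kernel \<sigma> x y)"
    using \<open>h \<noteq> 0\<close> not_integrable_integral_eq unfolding h_def h_fun_def by blast
  \<comment> \<open>The unit vector \<open>b\<close> gives reference points \<open>p\<close> and
    \<open>q\<close> on the spheres of radius \<open>r\<close> and
    \<open>(1 + \<delta>) * r\<close>. Its direction is immaterial, the kernel being radial.\<close>
  obtain b :: 'a where b: "b \<in> Basis" using nonempty_Basis by blast
  define p where "p = y + r *\<^sub>R b"
  define q where "q = y + ((1 + \<delta>) * r) *\<^sub>R b"
  have p: "norm (p - y) = r" and q: "norm (q - y) = (1 + \<delta>) * r"
    using pos b by (simp_all add: p_def q_def abs_mult)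
  then have py: "p \<noteq> y" and qy: "q \<noteq> y"
    using pos by auto
  define G1 G2 where "G1 = G_kernel \<sigma> p y" and "G2 = G_kernel \<sigma> q y"
  have decay: "G2 \<le> (1 + \<delta>) powr (2 - real DIM('a)) * G1"
    unfolding G1_def G2_def using pos p q py by (intro G_kernel_decay \<sigma>) auto
  \<comment> \<open>Lower bound for the normalising constant: on the small ball the kernel is almost
    everywhere at least its value \<open>G1\<close> on the bounding sphere.\<close>
  have "\<epsilon> * G1 \<le> measure \<alpha> (ball y r) * G1"
    using mass by (intro mult_right_mono) (auto simp: G1_def G_kernel_nonneg)
  also have "\<dots> = (\<integral>x. G1 * indicator (ball y r) x \<partial>\<alpha>)"
    using \<alpha>(2) sets_eq_imp_space_eq[OF \<alpha>(2)] by simp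
  also have "\<dots> \<le> (\<integral>x. G_kernel \<sigma> x y \<partial>\<alpha>)"
  proof (rule integral_mono_AE)
    show "integrable \<alpha> (\<lambda>x. G1 * indicator (ball y r) x)"
      using \<alpha>(2) \<alpha>.emeasure_finite by (intro integrable_mult_right integrable_real_indicator)
        (auto simp: top.not_eq_extremum[symmetric])
    show "AE x in \<alpha>. G1 * indicator (ball y r) x \<le> G_kernel \<sigma> x y"
      using AE_in_measure_support[OF \<alpha>(2)]
    proof eventually_elim
      case (elim x)
      \<comment> \<open>The centre, where the formal value 0 would spoil the lower bound, lies
        outside the support and is thus avoided almost everywhere.\<close>
      then have "x \<noteq> y" using y by auto
      then show ?case
        using p dim \<sigma> unfolding G1_def
        by (auto simp: indicator_def G_kernel_nonneg dist_norm norm_minus_commute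
            intro!: G_kernel_antimono)
    qed
  qed (rule int)
  finally have G1_le: "\<epsilon> * G1 \<le> h"
    by (simp add: h_def h_fun_def)
  have ratio: "G2 / h \<le> (1 / \<epsilon>) * (1 + \<delta>) powr (2 - real DIM('a))"
  proof -
    have "\<epsilon> * G2 \<le> (1 + \<delta>) powr (2 - real DIM('a)) * (\<epsilon> * G1)"
      using mult_left_mono[OF decay, of \<epsilon>] pos by (simp add: mult_ac)
    also have "\<dots> \<le> (1 + \<delta>) powr (2 - real DIM('a)) * h"
      using G1_le by (intro mult_left_mono) auto
    finally show ?thesis
      using h pos by (simp add: field_simps)
  qed
  have "emeasure (density \<alpha> (\<lambda>x. ennreal (G_kernel \<sigma> x y / h))) (- ball y ((1 + \<delta>) * r))
      = (\<integral>\<^sup>+x. ennreal (G_kernel \<sigma> x y / h) * indicator (- ball y ((1 + \<delta>) * r)) x \<partial>\<alpha>)"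
    using \<alpha>(2) by (intro emeasure_density) auto
  \<comment> \<open>Outside the large ball the kernel is at most its value \<open>G2\<close> on the
    bounding sphere, and \<alpha> has total mass 1.\<close>
  also have "\<dots> \<le> (\<integral>\<^sup>+x. ennreal (G2 / h) \<partial>\<alpha>)"
  proof (intro nn_integral_mono)
    fix x
    have "G_kernel \<sigma> x y \<le> G2" if "x \<notin> ball y ((1 + \<delta>) * r)"
      unfolding G2_def using that q qy dim
      by (intro G_kernel_antimono \<sigma>) (auto simp: dist_norm norm_minus_commute)
    then show "ennreal (G_kernel \<sigma> x y / h) * indicator (- ball y ((1 + \<delta>) * r)) x \<le> ennreal (G2 / h)"
      using h by (auto simp: indicator_def intro!: ennreal_leI divide_right_mono)
  qed
  also have "\<dots> = ennreal (G2 / h)"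
    by (simp add: \<alpha>.emeasure_space_1)
  finally have "measure (density \<alpha> (\<lambda>x. ennreal (G_kernel \<sigma> x y / h))) (- ball y ((1 + \<delta>) * r)) \<le> G2 / h"
    using h by (simp add: measure_def G2_def G_kernel_nonneg enn2real_leI)
  with ratio show ?thesis
    by (simp add: h_def)
qed

theorem theorem3p1:
  fixes \<sigma> \<delta> \<epsilon> r :: real
    and \<alpha> :: "(real ^ 'n) measure"
    and M :: "(real ^ 'n) set"
    and P :: "'w measure"
    and X0 :: "'w \<Rightarrow> real ^ 'n"
    and W Y :: "real \<Rightarrow> 'w \<Rightarrow> real ^ 'n"
    and \<tau> \<zeta> :: "'w \<Rightarrow> real"
    and \<kappa> :: "real ^ 'n \<Rightarrow> (real ^ 'n) measure"
    and y :: "real ^ 'n"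
  assumes dim: "CARD('n) \<ge> 3" and sigma: "\<sigma> > 0"
    and alpha: "prob_space \<alpha>" "sets \<alpha> = sets borel"
    and M_def: "M = measure_support \<alpha>"
    and M_polar: "polar M"
    and X0: "prob_space P" "X0 \<in> borel_measurable P" "distr P borel X0 = \<alpha>"
    and W: "brownian_motion P W" "AE \<omega> in P. W 0 \<omega> = 0"
    and tau: "distributed P lborel \<tau> (\<lambda>t. ennreal (exponential_density (1 / \<sigma>\<^sup>2) t))"
    and indep: "prob_space.indep_sets P
       (\<lambda>i. [gen_events P X0 borel,
             gen_events P (\<lambda>\<omega>. \<lambda>t\<in>{0..}. W t \<omega>) (\<Pi>\<^sub>M t\<in>{0..}. borel),
             gen_events P \<tau> borel] ! i) {..<3}"
    and Y_def: "Y = backward_process X0 W \<tau>"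
    and zeta_def: "\<zeta> = hitting_time Y M"
    and kappa_cond_law: "regular_conditional_law P (Y 0) (\<lambda>\<omega>. Y (\<zeta> \<omega>) \<omega>) \<kappa>"
    and kappa_off_M: "\<And>z. z \<notin> M \<Longrightarrow>
       \<kappa> z = density \<alpha> (\<lambda>x. ennreal (G_kernel \<sigma> x z / h_fun \<sigma> \<alpha> z))"
    and kappa_on_M: "\<And>z. z \<in> M \<Longrightarrow> \<kappa> z = return borel z"
    and pos: "\<delta> > 0" "\<epsilon> > 0" "r > 0"
    and mass: "measure \<alpha> (ball y r) > \<epsilon>"
  shows "measure (\<kappa> y) (M \<inter> ball y ((1 + \<delta>) * r))
           \<ge> 1 - (1 / \<epsilon>) * (1 + \<delta>) powr (2 - real CARD('n))"
proof (cases "y \<in> M")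
  case True
  \<comment> \<open>The Dirac measure at \<open>y\<close> gives full mass to a Borel set containing
    \<open>y\<close>; closedness of the support makes the set Borel.\<close>
  then have "measure (\<kappa> y) (M \<inter> ball y ((1 + \<delta>) * r)) = 1"
    using pos closed_measure_support[of \<alpha>]
    by (simp add: kappa_on_M measure_return M_def borel_closed)
  then show ?thesis
    using pos by simp
next
  case False
  let ?B = "ball y ((1 + \<delta>) * r)"
  have M [measurable]: "M \<in> sets borel"
    using closed_measure_support[of \<alpha>] by (simp add: M_def borel_closed)
  have "\<kappa> \<in> borel \<rightarrow>\<^sub>M prob_algebra borel"
    using kappa_cond_law by (simp add: regular_conditional_law_def)
  \<comment> \<open>This normalisation is what makes \<open>h_fun \<sigma> \<alpha> y\<close>
    nonzero in the estimate outside the ball.\<close>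
  then have \<kappa>: "prob_space (\<kappa> y)" "sets (\<kappa> y) = sets borel"
    by (auto dest!: measurable_space[of _ _ _ y] simp: space_prob_algebra)
  interpret K: prob_space "\<kappa> y" by fact
  note [measurable_cong] = \<kappa>(2) alpha(2)
  \<comment> \<open>Having a density with respect to \<alpha>, the posterior lives on the support,
    so intersecting with \<open>M\<close> loses no mass and only the complement of the ball must be
    estimated.\<close>
  have "AE x in \<kappa> y. x \<in> M"
    unfolding kappa_off_M[OF False]
    using AE_in_measure_support[OF alpha(2)] by (subst AE_density) (auto simp: M_def)
  then have "measure (\<kappa> y) (M \<inter> ?B) = measure (\<kappa> y) ?B"
    by (intro K.finite_measure_eq_AE) (auto simp: \<kappa>(2))
  also have "\<dots> = 1 - measure (\<kappa> y) (- ?B)"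
    using K.prob_compl[of ?B] \<kappa>(2) sets_eq_imp_space_eq[OF \<kappa>(2)] by (simp add: Compl_eq_Diff_UNIV)
  finally show ?thesis
    using G_posterior_outside_ball[of \<sigma> \<alpha> y \<delta> \<epsilon> r] dim sigma alpha False \<kappa>(1) pos mass
    by (simp add: kappa_off_M[OF False] M_def)
qed

end
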